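(* Let $\theta\in[0,\frac{\pi}{2})$ with $\tan\theta=\frac MN$ rational, where $M\ge0$ and $N\ge1$ are integers, and let $\sigma\in\{0,1\}^{\mathbb N}$ be such that the frequencies $n_0=\lim_{k\to\infty}\frac{n_0(k)}{k}$ and $n_1=\lim_{k\to\infty}\frac{n_1(k)}{k}$ exist. Let $\alpha\in\mathbb R$ be such that $$E(\alpha)=\{a\in J_\theta:\dim_B(F_\sigma\cap L_a)=\alpha\}\neq\emptyset.$$ Then $$\dim_H(E(\alpha))\le\inf_{q\in\mathbb R}\left\{-q\alpha+\frac{P_A(q)}{n_0\log3+n_1\log4}\right\}.$$
   Context: Carpet. Let $\Omega_0=\{(0,0),(0,1),(0,2),(1,0),(1,2),(2,0),(2,1),(2,2)\}$ and $\Omega_1=\{(0,0),(0,1),(0,2),(0,3),(1,0),(1,3),(2,0),(2,1),(3,0),(3,1),(3,2),(3,3)\}$; write $d=(d^1,d^2)$ for their elements. Define maps of $\mathbb R^2$ by $\Phi^0_d(x,y)=\frac{(x,y)+d}{3}$ for $d\in\Omega_0$ and $\Phi^1_d(x,y)=\frac{(x,y)+d}{4}$ for $d\in\Omega_1$. For $\sigma\in\{0,1\}^{\mathbb N}$ let $n_0(k)=\#\{1\le i\le k:\sigma_i=0\}$ and $n_1(k)=\#\{1\le i\le k:\sigma_i=1\}$. Let $F_0=[0,1]^2$, for $j\ge1$ let $F_j$ be the union of the squares $\Phi^{\sigma_1}_{d_1}\circ\cdots\circ\Phi^{\sigma_j}_{d_j}(F_0)$ over all $d_1\in\Omega_{\sigma_1},\ldots,d_j\in\Omega_{\sigma_j}$,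 and let $F_\sigma=\bigcap_{j\ge1}F_j$. Line. $L_a=\{(x,y)\in\mathbb R^2: y=x\tan\theta+a\}$ and $J_\theta=[-\frac MN,1]$. Matrices. These are $(N+M)\times(N+M)$ matrices with index range $1\le p,q\le N+M$: for $j\in\{0,1,2\}$, $(A_0^j)_{pq}=\#\{d\in\Omega_0: d^1M-d^2N=2M+2+q-3p-j\}$; for $j\in\{0,1,2,3\}$, $(A_1^j)_{pq}=\#\{d\in\Omega_1: d^1M-d^2N=3M+3+q-4p-j\}$. $\|\cdot\|$ denotes the sum of all entries of a matrix. Expansion. For $a\in J_\theta$ let $\kappa\in\{1,\ldots,N+M\}$ be the index with $a\in[\frac{-M-1+\kappa}{N},\frac{-M+\kappa}{N})$ (the interval with $\kappa=N+M$ taken closed), and let $a=\frac{-M-1+\kappa}{N}+\frac1N\sum_{i\ge1}\frac{\xi_i}{3^{n_0(i)}4^{n_1(i)}}$ be the greedy expansion: $\xi_i\in\{0,1,2\}$ if $\sigma_i=0$, $\xi_i\in\{0,1,2,3\}$ if $\sigma_i=1$, and successively $\xi_i$ is the largest allowed digit for which the $i$-th partial sum is $\le a$. Standing assumption. Only those $a$ are considered for which the box dimension of $F_\sigma\cap L_a$ exists and is given by $$\dim_B(F_\sigma\cap L_a)=\lim_{k\to\infty}\frac{\log\|A_{\sigma_1}^{\xi_1}A_{\sigma_2}^{\xi_2}\cdots A_{\sigma_k}^{\xi_k}\|}{n_0(k)\log3+n_1(k)\log4};$$ thus $E(\alpha)$ is the set of $a\in J_\theta$ for which this holds (in particular the limit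 exists) and the common value is $\alpha$. Pressure. Let $\Sigma_0=\{0,1,2\}$, $\Sigma_1=\{0,1,2,3\}$, $\Sigma_\sigma^k=\prod_{i=1}^k\Sigma_{\sigma_i}$. For $q\in\mathbb R$, $$P_A(q)=\limsup_{k\to\infty}\frac1k\log\sum_{x\in\Sigma_\sigma^k}\|A_{\sigma_1}^{x_1}A_{\sigma_2}^{x_2}\cdots A_{\sigma_k}^{x_k}\|^q.$$ $\dim_H$ is Hausdorff dimension (in $\mathbb R$). *)

theory Defs
  imports "HOL-Analysis.Analysis" "Jordan_Normal_Form.Matrix"
begin

section \<open>Hausdorff and box dimension\<close>

(* The convention is 0^0 = 1 for nonempty sets, so that the 0-dimensional measure is counting
   measure; powr would give 0. *)
definition diam_power :: "real \<Rightarrow> 'a::metric_space set \<Rightarrow> ennreal" where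
  "diam_power s U = (if U = {} then 0 else if s = 0 then 1 else ennreal (diameter U powr s))"

(* Boundedness is required explicitly because the library's diameter is an unspecified real number
   on unbounded sets. *)
definition delta_cover :: "real \<Rightarrow> 'a::metric_space set \<Rightarrow> (nat \<Rightarrow> 'a set) \<Rightarrow> bool" where
  "delta_cover \<delta> X U \<longleftrightarrow> X \<subseteq> (\<Union>i. U i) \<and> (\<forall>i. bounded (U i) \<and> diameter (U i) \<le> \<delta>)"

definition hausdorff_premeasure :: "real \<Rightarrow> real \<Rightarrow> 'a::metric_space set \<Rightarrow> ennreal" where
  "hausdorff_premeasure s \<delta> X = (INF U\<in>{U. delta_cover \<delta> X U}. \<Sum>i. diam_power s (U i))"

definition hausdorff_measure :: "real \<Rightarrow> 'a::metric_space set \<Rightarrow> ennreal" where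
  "hausdorff_measure s X = (SUP \<delta>\<in>{0<..}. hausdorff_premeasure s \<delta> X)"

definition hausdorff_dim :: "'a::metric_space set \<Rightarrow> ereal" where
  "hausdorff_dim X = Inf {ereal s | s. 0 \<le> s \<and> hausdorff_measure s X = 0}"

definition covering_number :: "real \<Rightarrow> 'a::metric_space set \<Rightarrow> nat" where
  "covering_number \<delta> X = (LEAST n. \<exists>C. finite C \<and> card C = n \<and> X \<subseteq> \<Union>C \<and>
     (\<forall>U\<in>C. bounded U \<and> diameter U \<le> \<delta>))"

(* "The box dimension of X exists and equals s." *)
definition has_box_dim :: "'a::metric_space set \<Rightarrow> real \<Rightarrow> bool" where
  "has_box_dim X s \<longleftrightarrow> X \<noteq> {} \<and> bounded X \<and>
     ((\<lambda>\<delta>. ln (real (covering_number \<delta> X)) / (- ln \<delta>)) \<longlongrightarrow> s) (at_right 0)"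

section \<open>The carpet\<close>

(* A sequence over {0,1} is a function on nat read at the indices 1, 2, 3, ...; its value at 0
   is never used. The symbols 0 and 1 stand for subdivision into base 3 and base 4. *)

definition base :: "nat \<Rightarrow> nat" where
  "base s = (if s = 0 then 3 else 4)"

definition \<Omega> :: "nat \<Rightarrow> (int \<times> int) set" where
  "\<Omega> s = (if s = 0
     then {(0,0),(0,1),(0,2),(1,0),(1,2),(2,0),(2,1),(2,2)}
     else {(0,0),(0,1),(0,2),(0,3),(1,0),(1,3),(2,0),(2,1),(3,0),(3,1),(3,2),(3,3)})"

definition \<Phi> :: "nat \<Rightarrow> int \<times> int \<Rightarrow> real \<times> real \<Rightarrow> real \<times> real" where
  "\<Phi> s d z = ((fst z + of_int (fst d)) / real (base s), (snd z + of_int (snd d)) / real (base s))"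

primrec \<Phi>_word :: "(nat \<Rightarrow> nat) \<Rightarrow> (nat \<Rightarrow> int \<times> int) \<Rightarrow> nat \<Rightarrow> real \<times> real \<Rightarrow> real \<times> real" where
  "\<Phi>_word \<sigma> d 0 = id"
| "\<Phi>_word \<sigma> d (Suc j) = \<Phi>_word \<sigma> d j \<circ> \<Phi> (\<sigma> (Suc j)) (d (Suc j))"

definition carpet_level :: "(nat \<Rightarrow> nat) \<Rightarrow> nat \<Rightarrow> (real \<times> real) set" where
  "carpet_level \<sigma> j = (\<Union>d\<in>(\<Pi>\<^sub>E i\<in>{1..j}. \<Omega> (\<sigma> i)). \<Phi>_word \<sigma> d j ` ({0..1} \<times> {0..1}))"

definition carpet :: "(nat \<Rightarrow> nat) \<Rightarrow> (real \<times> real) set" where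
  "carpet \<sigma> = (\<Inter>j\<in>{1..}. carpet_level \<sigma> j)"

definition line :: "real \<Rightarrow> real \<Rightarrow> (real \<times> real) set" where
  "line \<theta> a = {(x, y). y = x * tan \<theta> + a}"

definition J :: "nat \<Rightarrow> nat \<Rightarrow> real set" where
  "J M N = {- (real M / real N)..1}"

definition occ :: "(nat \<Rightarrow> nat) \<Rightarrow> nat \<Rightarrow> nat \<Rightarrow> nat" where
  "occ \<sigma> s k = card {i \<in> {1..k}. \<sigma> i = s}"

section \<open>Matrices\<close>

(* Library matrices are indexed from 0, hence the shifts p = i + 1 and q = j' + 1. *)
definition A_mat :: "nat \<Rightarrow> nat \<Rightarrow> nat \<Rightarrow> nat \<Rightarrow> real mat" where
  "A_mat M N s j = Matrix.mat (N + M) (N + M) (\<lambda>(i, j').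
     let p = int i + 1; q = int j' + 1 in
     real (card {d \<in> \<Omega> s. fst d * int M - snd d * int N =
       (if s = 0 then 2 * int M + 2 + q - 3 * p - int j
        else 3 * int M + 3 + q - 4 * p - int j)}))"

primrec A_prod :: "nat \<Rightarrow> nat \<Rightarrow> (nat \<Rightarrow> nat) \<Rightarrow> (nat \<Rightarrow> nat) \<Rightarrow> nat \<Rightarrow> real mat" where
  "A_prod M N \<sigma> x 0 = 1\<^sub>m (N + M)"
| "A_prod M N \<sigma> x (Suc k) = A_prod M N \<sigma> x k * A_mat M N (\<sigma> (Suc k)) (x (Suc k))"

section \<open>Greedy expansion\<close>

definition kappa :: "nat \<Rightarrow> nat \<Rightarrow> real \<Rightarrow> nat" where
  "kappa M N a = (THE \<kappa>. \<kappa> \<in> {1..N + M} \<and>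
     (let l = (- real M - 1 + real \<kappa>) / real N; r = (- real M + real \<kappa>) / real N in
      if \<kappa> = N + M then a \<in> {l..r} else a \<in> {l..<r}))"

definition scale :: "(nat \<Rightarrow> nat) \<Rightarrow> nat \<Rightarrow> real" where
  "scale \<sigma> i = 3 ^ occ \<sigma> 0 i * 4 ^ occ \<sigma> 1 i"

(* The largest i-th digit that may follow the (i-1)-st partial sum S. *)
definition next_digit :: "nat \<Rightarrow> (nat \<Rightarrow> nat) \<Rightarrow> real \<Rightarrow> nat \<Rightarrow> real \<Rightarrow> nat" where
  "next_digit N \<sigma> a i S = Max {t. t < base (\<sigma> i) \<and> S + real t / (real N * scale \<sigma> i) \<le> a}"

primrec greedy_sum :: "nat \<Rightarrow> nat \<Rightarrow> (nat \<Rightarrow> nat) \<Rightarrow> real \<Rightarrow> nat \<Rightarrow> real" where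
  "greedy_sum M N \<sigma> a 0 = (- real M - 1 + real (kappa M N a)) / real N"
| "greedy_sum M N \<sigma> a (Suc i) = greedy_sum M N \<sigma> a i +
     real (next_digit N \<sigma> a (Suc i) (greedy_sum M N \<sigma> a i)) / (real N * scale \<sigma> (Suc i))"

definition greedy_digit :: "nat \<Rightarrow> nat \<Rightarrow> (nat \<Rightarrow> nat) \<Rightarrow> real \<Rightarrow> nat \<Rightarrow> nat" where
  "greedy_digit M N \<sigma> a i = next_digit N \<sigma> a i (greedy_sum M N \<sigma> a (i - 1))"

section \<open>Level sets and pressure\<close>

definition E_level :: "real \<Rightarrow> nat \<Rightarrow> nat \<Rightarrow> (nat \<Rightarrow> nat) \<Rightarrow> real \<Rightarrow> real set" where
  "E_level \<theta> M N \<sigma> \<alpha> = {a \<in> J M N.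
     has_box_dim (carpet \<sigma> \<inter> line \<theta> a) \<alpha> \<and>
     (\<lambda>k. ln (sum_mat (A_prod M N \<sigma> (greedy_digit M N \<sigma> a) k)) /
           (real (occ \<sigma> 0 k) * ln 3 + real (occ \<sigma> 1 k) * ln 4)) \<longlonglongrightarrow> \<alpha>}"

(* The powr never meets the base 0: every line of nonnegative slope meeting the unit square enters
   it through the left or bottom edge, and both \<Omega> 0 and \<Omega> 1 contain all cells along these edges.
   So each A_mat with an admissible digit has a positive entry in every row, and every product
   has entry sum at least 1. *)
definition pressure :: "nat \<Rightarrow> nat \<Rightarrow> (nat \<Rightarrow> nat) \<Rightarrow> real \<Rightarrow> ereal" where
  "pressure M N \<sigma> q = limsup (\<lambda>k. ereal (1 / real k *
     ln (\<Sum>x\<in>(\<Pi>\<^sub>E i\<in>{1..k}. {..<base (\<sigma> i)}). sum_mat (A_prod M N \<sigma> x k) powr q)))"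

end

theory Submission
  imports Defs
begin

text \<open>For \<open>a \<in> E(\<alpha>)\<close> the greedy word of \<open>a\<close> of length \<open>k\<close> has matrix norm about
  \<open>s\<^sub>k powr \<alpha>\<close> for all large \<open>k\<close>, where \<open>s\<^sub>k = 3\<^bsup>n\<^sub>0(k)\<^esup> 4\<^bsup>n\<^sub>1(k)\<^esup>\<close>. A Chebyshev bound on the
  partition sum shows that at most \<open>exp (k (P(q) + o(1))) s\<^sub>k powr (- q \<alpha> + o(1))\<close> words do so, and each
  of them confines \<open>a\<close> to \<open>N + M\<close> intervals of length \<open>1 / (N s\<^sub>k)\<close>. Since \<open>ln s\<^sub>k / k\<close> converges to
  \<open>n\<^sub>0 ln 3 + n\<^sub>1 ln 4\<close>, the \<open>s\<close>-costs of these covers are summable over \<open>k\<close> as soon as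
  \<open>s > - q \<alpha> + P(q) / (n\<^sub>0 ln 3 + n\<^sub>1 ln 4)\<close>, and \<open>E(\<alpha>)\<close> lies in the limes superior of the covers.
  That no matrix product vanishes and that \<open>P(q) \<noteq> -\<infinity>\<close> has to be checked separately; the
  latter uses a point of \<open>E(\<alpha>)\<close>.\<close>

section \<open>Hausdorff measure of limsup sets\<close>

text \<open>Empty sets cost 0 in \<open>diam_power\<close>, so each finite family can be padded to a
  sequence. The pairing bijection merges the resulting double sequence into one cover, and in
  \<open>ennreal\<close> the double series may be rearranged freely. The padding sets have diameter
  0, hence \<open>0 \<le> \<delta>\<close>.\<close>

lemma hausdorff_premeasure_le_suminf:
  fixes C :: "nat \<Rightarrow> 'a::metric_space set set"
  assumes fin: "\<And>k. finite (C k)"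
    and cov: "X \<subseteq> (\<Union>k. \<Union>(C k))"
    and small: "\<And>k U. U \<in> C k \<Longrightarrow> bounded U \<and> diameter U \<le> \<delta>"
    and "0 \<le> \<delta>"
  shows "hausdorff_premeasure s \<delta> X \<le> (\<Sum>k. \<Sum>U\<in>C k. diam_power s U)"
proof -
  define V where "V k i = (if i < card (C k) then from_nat_into (C k) i else {})" for k i
  have bij: "bij_betw (from_nat_into (C k)) {..<card (C k)} (C k)" for k
    using bij_betw_from_nat_into_finite[OF fin] by (simp add: lessThan_atLeast0)
  have "delta_cover \<delta> X (\<lambda>n. V (fst (prod_decode n)) (snd (prod_decode n)))"
    unfolding delta_cover_def
  proof safe
    fix x assume "x \<in> X"
    then obtain k U where "x \<in> U" "U \<in> C k" using cov by blast
    then obtain i where "i < card (C k)" "U = from_nat_into (C k) i"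
      using bij[of k] unfolding bij_betw_def by blast
    then have "x \<in> V k i" using \<open>x \<in> U\<close> by (simp add: V_def)
    then show "x \<in> (\<Union>n. V (fst (prod_decode n)) (snd (prod_decode n)))"
      by (intro UN_I[of "prod_encode (k, i)"]) auto
  next
    fix n
    have *: "V k i = {} \<or> V k i \<in> C k" for k i
      using bij[of k] unfolding bij_betw_def V_def by auto
    show "bounded (V (fst (prod_decode n)) (snd (prod_decode n)))"
      "diameter (V (fst (prod_decode n)) (snd (prod_decode n))) \<le> \<delta>"
      using small *[of "fst (prod_decode n)" "snd (prod_decode n)"] \<open>0 \<le> \<delta>\<close> by auto
  qed
  then have "hausdorff_premeasure s \<delta> X \<le>
      (\<Sum>n. diam_power s (V (fst (prod_decode n)) (snd (prod_decode n))))"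
    unfolding hausdorff_premeasure_def by (intro INF_lower) simp
  also have "\<dots> = (\<Sum>k. \<Sum>i. diam_power s (V k i))"
    by (rule suminf_ennreal_2dimen) (simp add: case_prod_beta)
  also have "\<dots> = (\<Sum>k. \<Sum>U\<in>C k. diam_power s U)"
  proof (intro suminf_cong)
    fix k
    have "(\<Sum>i. diam_power s (V k i)) = (\<Sum>i<card (C k). diam_power s (V k i))"
      by (intro suminf_finite) (auto simp: V_def diam_power_def)
    also have "\<dots> = (\<Sum>i<card (C k). diam_power s (from_nat_into (C k) i))"
      by (simp add: V_def)
    also have "\<dots> = (\<Sum>U\<in>C k. diam_power s U)"
      using sum.reindex_bij_betw[OF bij] .
    finally show "(\<Sum>i. diam_power s (V k i)) = (\<Sum>U\<in>C k. diam_power s U)" .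
  qed
  finally show ?thesis .
qed

text \<open>A Borel-Cantelli argument: each point lies in infinitely many
  \<open>\<Union>(C k)\<close>, so every tail of the families still covers \<open>X\<close>, while
  the tail of the summable costs is arbitrarily small. As \<open>d\<close> tends to 0, late families
  are admissible for any \<delta>.\<close>

lemma hausdorff_measure_eq_0_if_limsup_cover:
  fixes C :: "nat \<Rightarrow> 'a::metric_space set set" and d b :: "nat \<Rightarrow> real"
  assumes fin: "\<And>k. finite (C k)"
    and cov: "\<And>x. x \<in> X \<Longrightarrow> \<exists>\<^sub>F k in sequentially. x \<in> \<Union>(C k)"
    and small: "\<And>k U. U \<in> C k \<Longrightarrow> bounded U \<and> diameter U \<le> d k"
    and d: "d \<longlonglongrightarrow> 0"
    and cost: "\<forall>\<^sub>F k in sequentially. (\<Sum>U\<in>C k. diam_power s U) \<le> ennreal (b k)"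
    and b: "\<And>k. 0 \<le> b k" "summable b"
  shows "hausdorff_measure s X = 0"
proof -
  have le: "hausdorff_premeasure s \<delta> X \<le> ennreal e" if "\<delta> > 0" "e > 0" for \<delta> e :: real
  proof -
    have "\<forall>\<^sub>F k in sequentially. d k < \<delta>"
      using order_tendstoD(2)[OF d \<open>\<delta> > 0\<close>] .
    from eventually_conj[OF this cost]
    obtain K1 where K1: "\<And>k. k \<ge> K1 \<Longrightarrow> d k < \<delta> \<and> (\<Sum>U\<in>C k. diam_power s U) \<le> ennreal (b k)"
      by (auto simp: eventually_sequentially)
    obtain K2 where K2: "\<And>k. k \<ge> K2 \<Longrightarrow> norm (\<Sum>i. b (i + k)) < e"
      using suminf_exist_split[OF \<open>e > 0\<close> b(2)] by blast
    define K where "K = max K1 K2"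
    have "X \<subseteq> (\<Union>k. \<Union>(C (k + K)))"
    proof
      fix x assume "x \<in> X"
      then obtain k where "k \<ge> K" "x \<in> \<Union>(C k)"
        using cov unfolding frequently_sequentially by blast
      then show "x \<in> (\<Union>k. \<Union>(C (k + K)))"
        by (intro UN_I[of "k - K"]) auto
    qed
    moreover have "bounded U \<and> diameter U \<le> \<delta>" if "U \<in> C (k + K)" for k U
      using small[OF that] K1[of "k + K"] by (force simp: K_def)
    ultimately have "hausdorff_premeasure s \<delta> X \<le> (\<Sum>k. \<Sum>U\<in>C (k + K). diam_power s U)"
      using \<open>\<delta> > 0\<close> fin by (intro hausdorff_premeasure_le_suminf) auto
    also have "\<dots> \<le> (\<Sum>k. ennreal (b (k + K)))"
      using K1 by (intro suminf_le) (auto simp: K_def)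
    also have "\<dots> = ennreal (\<Sum>k. b (k + K))"
      using b by (intro suminf_ennreal2) (auto simp: summable_iff_shift)
    also have "\<dots> \<le> ennreal e"
      using K2[of K] by (intro ennreal_leI) (auto simp: K_def)
    finally show ?thesis .
  qed
  have "hausdorff_premeasure s \<delta> X \<le> 0" if "\<delta> > 0" for \<delta>
  proof (rule ennreal_le_epsilon)
    show "hausdorff_premeasure s \<delta> X \<le> 0 + ennreal e" if "e > 0" for e
      using le[OF \<open>\<delta> > 0\<close> that] by simp
  qed
  then have "hausdorff_measure s X \<le> 0"
    unfolding hausdorff_measure_def by (intro SUP_least) simp
  then show ?thesis by simp
qed

section \<open>Nonvanishing of the matrix products\<close>

lemma finite_\<Omega>: "finite (\<Omega> s)"
  by (simp add: \<Omega>_def)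

lemma A_mat_nonneg: "i < N + M \<Longrightarrow> j' < N + M \<Longrightarrow> 0 \<le> A_mat M N s j $$ (i, j')"
  by (simp add: A_mat_def Let_def)

text \<open>A discrete intermediate value argument: from a value above \<open>w\<close>, a drop of
  at most \<open>w\<close> lands at 1 or higher, so the path cannot jump over the window.\<close>

lemma int_path_hits_window:
  fixes f :: "nat \<Rightarrow> int"
  assumes "1 \<le> f 0" "f n \<le> w" "\<And>k. f k - f (Suc k) \<le> w"
  shows "\<exists>k\<le>n. 1 \<le> f k \<and> f k \<le> w"
  using assms(2)
proof (induction n)
  case 0
  then show ?case using assms(1) by auto
next
  case (Suc n)
  show ?case
  proof (cases "f n \<le> w")
    case True
    then show ?thesis using Suc.IH le_Suc_eq by blast
  next
    case False
    then have "1 \<le> f (Suc n)" using assms(3)[of n] by linarith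
    then show ?thesis using Suc.prems by blast
  qed
qed

text \<open>Along the bottom edge from right to left and then up the left edge, all cells of which belong
  to \<open>\<Omega> s\<close>, the value of \<open>d\<^sup>1 M - d\<^sup>2 N\<close> drops by \<open>M\<close> or \<open>N\<close> at each step, so the column index it
  determines cannot jump over the window \<open>{1..N + M}\<close>.\<close>

lemma A_mat_row_pos:
  assumes "i < N + M" "j < base s"
  shows "\<exists>j'<N + M. 1 \<le> A_mat M N s j $$ (i, j')"
proof -
  \<comment> \<open>\<open>c d\<close> is the column index q, counted from 1, that solves the
    defining equation of \<open>A_mat\<close> in row p = i + 1; thus \<open>d\<close> is counted in
    column \<open>c d\<close> whenever that value lies in \<open>{1..N + M}\<close>.\<close>
  define c where "c d = fst d * int M - snd d * int N - (int (base s) - 1) * (int M + 1)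
      + int (base s) * (int i + 1) + int j" for d :: "int \<times> int"
  have b: "base s \<in> {3, 4}" by (simp add: base_def)
  let ?b = "base s - 1"
  \<comment> \<open>Truncated subtraction makes the turn at the corner: the second coordinate is 0
    up to k = \<open>base s - 1\<close>, the first one is 0 from there on.\<close>
  define path where "path k = (int (?b - k), int (k - ?b))" for k
  have "\<exists>k\<le>2 * ?b. 1 \<le> c (path k) \<and> c (path k) \<le> int N + int M"
  proof (rule int_path_hits_window)
    \<comment> \<open>With b = \<open>base s\<close>, the start value is 1 + b i + j, and the end
      value is at most N + M - (b - 1) + j, which is where j < b enters.\<close>
    show "1 \<le> c (path 0)" using b by (auto simp: c_def path_def algebra_simps)
    have *: "3 * int i \<le> 3 * (int N + int M - 1)" "4 * int i \<le> 4 * (int N + int M - 1)"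
      using assms(1) by auto
    show "c (path (2 * ?b)) \<le> int N + int M"
      using b assms(2) * by (auto simp: c_def path_def algebra_simps)
    show "c (path k) - c (path (Suc k)) \<le> int N + int M" for k
    proof (cases "k < ?b")
      case True
      then have "int (?b - k) = int (?b - Suc k) + 1" "k - ?b = 0" "Suc k - ?b = 0" by auto
      then show ?thesis by (simp add: c_def path_def algebra_simps)
    next
      case False
      then have "int (Suc k - ?b) = int (k - ?b) + 1" "?b - k = 0" "?b - Suc k = 0" by auto
      then show ?thesis by (simp add: c_def path_def algebra_simps)
    qed
  qed
  then obtain k where k: "k \<le> 2 * ?b" "1 \<le> c (path k)" "c (path k) \<le> int N + int M"
    by blast
  have "path k \<in> \<Omega> s"
  proof (cases "s = 0")
    case True
    then have "k \<in> {0, 1, 2, 3, 4}" using k(1) by (simp add: base_def) linarith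
    then show ?thesis unfolding path_def \<Omega>_def base_def using True by (elim insertE) simp_all
  next
    case False
    then have "k \<in> {0, 1, 2, 3, 4, 5, 6}" using k(1) by (simp add: base_def) linarith
    then show ?thesis unfolding path_def \<Omega>_def base_def using False by (elim insertE) simp_all
  qed
  then obtain d where d: "d \<in> \<Omega> s" "1 \<le> c d" "c d \<le> int N + int M" using k by (intro that)
  define j' where "j' = nat (c d - 1)"
  have j': "j' < N + M" "int j' + 1 = c d" using d by (auto simp: j'_def)
  let ?D = "{d \<in> \<Omega> s. fst d * int M - snd d * int N =
       (if s = 0 then 2 * int M + 2 + (int j' + 1) - 3 * (int i + 1) - int j
        else 3 * int M + 3 + (int j' + 1) - 4 * (int i + 1) - int j)}"
  have "d \<in> ?D" using d(1) j'(2) by (auto simp: c_def base_def algebra_simps)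
  moreover have "finite ?D" using finite_\<Omega> by auto
  ultimately have "0 < card ?D" unfolding card_gt_0_iff by blast
  then have "1 \<le> A_mat M N s j $$ (i, j')"
    using assms(1) j'(1) by (simp add: A_mat_def Let_def)
  then show ?thesis using j'(1) by blast
qed

lemma A_mat_row_sum_ge_1:
  assumes "i < N + M" "j < base s"
  shows "1 \<le> (\<Sum>j'<N + M. A_mat M N s j $$ (i, j'))"
proof -
  obtain j' where "j' < N + M" "1 \<le> A_mat M N s j $$ (i, j')"
    using A_mat_row_pos[OF assms] by blast
  moreover have "A_mat M N s j $$ (i, j') \<le> (\<Sum>j'<N + M. A_mat M N s j $$ (i, j'))"
    using \<open>j' < N + M\<close> assms(1) by (intro member_le_sum) (auto simp: A_mat_nonneg)
  ultimately show ?thesis by linarith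
qed

lemma A_mat_carrier: "A_mat M N s j \<in> carrier_mat (N + M) (N + M)"
  by (simp add: A_mat_def)

lemma A_prod_carrier: "A_prod M N \<sigma> x k \<in> carrier_mat (N + M) (N + M)"
  by (induction k) (simp, simp, metis A_mat_carrier mult_carrier_mat)

lemma A_prod_Suc_index:
  assumes "i < N + M" "j < N + M"
  shows "A_prod M N \<sigma> x (Suc k) $$ (i, j) =
    (\<Sum>r<N + M. A_prod M N \<sigma> x k $$ (i, r) * A_mat M N (\<sigma> (Suc k)) (x (Suc k)) $$ (r, j))"
  using assms A_prod_carrier[of M N \<sigma> x k] A_mat_carrier[of M N "\<sigma> (Suc k)" "x (Suc k)"]
  by (simp add: scalar_prod_def lessThan_atLeast0)

lemma A_prod_nonneg: "i < N + M \<Longrightarrow> j < N + M \<Longrightarrow> 0 \<le> A_prod M N \<sigma> x k $$ (i, j)"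
proof (induction k arbitrary: j)
  case (Suc k)
  then show ?case
    by (auto simp: A_prod_Suc_index simp del: A_prod.simps intro!: sum_nonneg mult_nonneg_nonneg A_mat_nonneg)
qed simp

text \<open>Multiplying a nonnegative matrix on the right by one whose row sums are at least 1
  cannot decrease its row sums.\<close>

lemma A_prod_row_sum_ge_1:
  assumes "i < N + M" "\<And>l. l \<in> {1..k} \<Longrightarrow> x l < base (\<sigma> l)"
  shows "1 \<le> (\<Sum>j<N + M. A_prod M N \<sigma> x k $$ (i, j))"
  using assms(2)
proof (induction k)
  case 0
  then show ?case using assms(1) by simp
next
  case (Suc k)
  have "1 \<le> (\<Sum>r<N + M. A_prod M N \<sigma> x k $$ (i, r) * 1)"
    using Suc by simp
  also have "\<dots> \<le> (\<Sum>r<N + M. A_prod M N \<sigma> x k $$ (i, r) *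
      (\<Sum>j<N + M. A_mat M N (\<sigma> (Suc k)) (x (Suc k)) $$ (r, j)))"
    using assms(1) Suc.prems
    by (intro sum_mono mult_left_mono A_mat_row_sum_ge_1 A_prod_nonneg) auto
  also have "\<dots> = (\<Sum>j<N + M. A_prod M N \<sigma> x (Suc k) $$ (i, j))"
    using assms(1)
    by (simp add: A_prod_Suc_index sum_distrib_left del: A_prod.simps) (rule sum.swap)
  finally show ?case .
qed

text \<open>Row 0 exists because \<open>N \<ge> 1\<close> and alone contributes at least 1. This
  keeps every \<open>ln\<close> and \<open>powr\<close> of a norm away from the argument 0.\<close>

lemma sum_mat_A_prod_ge_1:
  assumes "N \<ge> 1" "\<And>l. l \<in> {1..k} \<Longrightarrow> x l < base (\<sigma> l)"
  shows "1 \<le> sum_mat (A_prod M N \<sigma> x k)"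
proof -
  have "1 \<le> (\<Sum>j<N + M. A_prod M N \<sigma> x k $$ (0, j))"
    using assms by (intro A_prod_row_sum_ge_1) auto
  also have "\<dots> \<le> (\<Sum>i<N + M. \<Sum>j<N + M. A_prod M N \<sigma> x k $$ (i, j))"
    using assms(1)
    by (intro member_le_sum[where f = "\<lambda>i. \<Sum>j<N + M. A_prod M N \<sigma> x k $$ (i, j)"])
      (auto intro!: sum_nonneg A_prod_nonneg)
  also have "\<dots> = sum_mat (A_prod M N \<sigma> x k)"
    using A_prod_carrier[of M N \<sigma> x k]
    by (simp add: sum_mat_def sum.cartesian_product lessThan_atLeast0)
  finally show ?thesis .
qed

lemma A_prod_cong:
  "(\<And>i. i \<in> {1..k} \<Longrightarrow> x i = y i) \<Longrightarrow> A_prod M N \<sigma> x k = A_prod M N \<sigma> y k"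
  by (induction k) auto

section \<open>Scales and greedy expansions\<close>

lemma occ_0: "occ \<sigma> s 0 = 0"
  by (simp add: occ_def)

lemma occ_Suc: "occ \<sigma> s (Suc k) = occ \<sigma> s k + (if \<sigma> (Suc k) = s then 1 else 0)"
proof -
  have "{i \<in> {1..Suc k}. \<sigma> i = s} =
      (if \<sigma> (Suc k) = s then insert (Suc k) {i \<in> {1..k}. \<sigma> i = s} else {i \<in> {1..k}. \<sigma> i = s})"
    by (auto simp: le_Suc_eq)
  then show ?thesis by (simp add: occ_def)
qed

lemma occ_0_plus_occ_1:
  assumes "\<forall>i\<ge>1. \<sigma> i \<in> {0, 1}"
  shows "occ \<sigma> 0 k + occ \<sigma> 1 k = k"
proof (induction k)
  case (Suc k)
  then show ?case using assms[rule_format, of "Suc k"] by (auto simp: occ_Suc)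
qed (simp add: occ_0)

lemma scale_pos: "0 < scale \<sigma> k"
  by (simp add: scale_def)

lemma scale_Suc:
  assumes "\<forall>i\<ge>1. \<sigma> i \<in> {0, 1}"
  shows "scale \<sigma> (Suc k) = real (base (\<sigma> (Suc k))) * scale \<sigma> k"
  using assms[rule_format, of "Suc k"] by (auto simp: scale_def occ_Suc base_def)

lemma ln_scale: "ln (scale \<sigma> k) = real (occ \<sigma> 0 k) * ln 3 + real (occ \<sigma> 1 k) * ln 4"
  by (simp add: scale_def ln_mult ln_realpow)

text \<open>\<open>kappa\<close> is a definite description, so the defining intervals must first be
  shown to partition \<open>J M N\<close>. The non-strict upper bound covers the closed last
  interval as well.\<close>

lemma kappa_bounds:
  assumes "N \<ge> 1" "a \<in> J M N"
  shows "kappa M N a \<in> {1..N + M}"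
    and "(- real M - 1 + real (kappa M N a)) / real N \<le> a"
    and "a \<le> (- real M + real (kappa M N a)) / real N"
proof -
  define P where "P \<kappa> \<longleftrightarrow> \<kappa> \<in> {1..N + M} \<and>
     (let l = (- real M - 1 + real \<kappa>) / real N; r = (- real M + real \<kappa>) / real N in
      if \<kappa> = N + M then a \<in> {l..r} else a \<in> {l..<r})" for \<kappa> :: nat
  \<comment> \<open>In this coordinate \<open>J M N\<close> becomes [0, N + M] and the interval of
    index \<kappa> becomes [\<kappa> - 1, \<kappa>), so the index is the floor of \<open>y\<close>
    plus 1, except at the right end.\<close>
  define y where "y = a * real N + real M"
  have y: "0 \<le> y" "y \<le> real (N + M)"
    using assms mult_right_mono[of a 1 "real N"] by (auto simp: J_def y_def field_simps)
  have P_iff: "P \<kappa> \<longleftrightarrow> \<kappa> \<in> {1..N + M} \<and> real \<kappa> - 1 \<le> y \<and>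
      (if \<kappa> = N + M then y \<le> real \<kappa> else y < real \<kappa>)" for \<kappa>
    using assms(1) by (auto simp: P_def y_def Let_def field_simps)
  have "\<exists>!\<kappa>. P \<kappa>"
  proof (cases "y < real (N + M)")
    case True
    obtain n :: nat where n: "real n \<le> y" "y < real n + 1"
      using y(1) by (intro that[of "nat \<lfloor>y\<rfloor>"]) linarith+
    then have "n < N + M" using True by linarith
    then have "P (Suc n)" using n True by (simp add: P_iff)
    moreover have "\<kappa> = Suc n" if "P \<kappa>" for \<kappa>
    proof -
      have "real \<kappa> - 1 \<le> y" "y < real \<kappa>" using that True by (auto simp: P_iff split: if_splits)
      then have "real \<kappa> < real (Suc n) + 1" "real (Suc n) < real \<kappa> + 1" using n by auto
      then show ?thesis by linarith
    qed
    ultimately show ?thesis by blast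
  next
    case False
    then have "y = real (N + M)" using y by simp
    then have "P \<kappa> \<longleftrightarrow> \<kappa> = N + M" for \<kappa> using assms(1) by (auto simp: P_iff)
    then show ?thesis by simp
  qed
  then have "P (kappa M N a)"
    unfolding kappa_def P_def by (rule theI')
  then show "kappa M N a \<in> {1..N + M}"
    and "(- real M - 1 + real (kappa M N a)) / real N \<le> a"
    and "a \<le> (- real M + real (kappa M N a)) / real N"
    by (auto simp: P_def Let_def split: if_splits)
qed

text \<open>The maximum exists because the digit 0 is admissible. Its successor either overshoots
  \<open>a\<close> or equals \<open>base (\<sigma> i)\<close>, and in the latter case the second
  assumption is the upper bound claimed.\<close>

lemma next_digit_bounds:
  assumes "S \<le> a" "a \<le> S + real (base (\<sigma> i)) / (real N * scale \<sigma> i)"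
  shows "next_digit N \<sigma> a i S < base (\<sigma> i)"
    and "S + real (next_digit N \<sigma> a i S) / (real N * scale \<sigma> i) \<le> a"
    and "a \<le> S + (real (next_digit N \<sigma> a i S) + 1) / (real N * scale \<sigma> i)"
proof -
  let ?T = "{t. t < base (\<sigma> i) \<and> S + real t / (real N * scale \<sigma> i) \<le> a}"
  have fin: "finite ?T" by (rule finite_subset[of _ "{..<base (\<sigma> i)}"]) auto
  have "0 \<in> ?T" using assms(1) by (simp add: base_def)
  then have mem: "next_digit N \<sigma> a i S \<in> ?T"
    unfolding next_digit_def using fin by (intro Max_in) auto
  then show "next_digit N \<sigma> a i S < base (\<sigma> i)"
    and "S + real (next_digit N \<sigma> a i S) / (real N * scale \<sigma> i) \<le> a" by auto
  show "a \<le> S + (real (next_digit N \<sigma> a i S) + 1) / (real N * scale \<sigma> i)"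
  proof (rule ccontr)
    assume less: "\<not> ?thesis"
    then have "Suc (next_digit N \<sigma> a i S) \<noteq> base (\<sigma> i)"
      using assms(2) by (metis of_nat_Suc add.commute)
    then have "Suc (next_digit N \<sigma> a i S) \<in> ?T"
      using mem less by (auto simp: add.commute)
    then have "Suc (next_digit N \<sigma> a i S) \<le> next_digit N \<sigma> a i S"
      unfolding next_digit_def using fin by (intro Max_ge)
    then show False by simp
  qed
qed

text \<open>The remainder never exceeds one cell of the current level. Such a cell consists of
  \<open>base (\<sigma> (Suc k))\<close> cells of the next level, which is what the choice of the
  next digit requires.\<close>

lemma greedy_sum_bounds:
  assumes "\<forall>i\<ge>1. \<sigma> i \<in> {0, 1}" "N \<ge> 1" "a \<in> J M N"
  shows "greedy_sum M N \<sigma> a k \<le> a \<and> a \<le> greedy_sum M N \<sigma> a k + 1 / (real N * scale \<sigma> k)"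
proof (induction k)
  case 0
  have "(- real M + real (kappa M N a)) / real N =
      (- real M - 1 + real (kappa M N a)) / real N + 1 / real N"
    by (simp add: add_divide_distrib[symmetric])
  then show ?case using kappa_bounds[OF assms(2,3)] by (simp add: scale_def occ_0)
next
  case (Suc k)
  have "real (base (\<sigma> (Suc k))) / (real N * scale \<sigma> (Suc k)) = 1 / (real N * scale \<sigma> k)"
    using scale_Suc[OF assms(1), of k] by (simp add: base_def)
  then have "a \<le> greedy_sum M N \<sigma> a k + real (base (\<sigma> (Suc k))) / (real N * scale \<sigma> (Suc k))"
    using Suc by simp
  from next_digit_bounds(2,3)[OF _ this] Suc show ?case
    by (simp add: add_divide_distrib)
qed

lemma greedy_digit_less_base:
  assumes "\<forall>i\<ge>1. \<sigma> i \<in> {0, 1}" "N \<ge> 1" "a \<in> J M N" "i \<ge> 1"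
  shows "greedy_digit M N \<sigma> a i < base (\<sigma> i)"
proof -
  obtain k where k: "i = Suc k" using assms(4) by (cases i) auto
  have "real (base (\<sigma> (Suc k))) / (real N * scale \<sigma> (Suc k)) = 1 / (real N * scale \<sigma> k)"
    using scale_Suc[OF assms(1), of k] by (simp add: base_def)
  then show ?thesis
    using greedy_sum_bounds[OF assms(1-3), of k] unfolding greedy_digit_def k
    by (intro next_digit_bounds(1)) auto
qed

lemma greedy_sum_eq:
  "greedy_sum M N \<sigma> a k = (- real M - 1 + real (kappa M N a)) / real N +
     (\<Sum>i\<in>{1..k}. real (greedy_digit M N \<sigma> a i) / (real N * scale \<sigma> i))"
  by (induction k) (simp_all add: greedy_digit_def)

section \<open>Digit words and their cylinders\<close>

abbreviation digit_words :: "(nat \<Rightarrow> nat) \<Rightarrow> nat \<Rightarrow> (nat \<Rightarrow> nat) set" where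
  "digit_words \<sigma> k \<equiv> \<Pi>\<^sub>E i\<in>{1..k}. {..<base (\<sigma> i)}"

text \<open>The pair consists of a starting index \<open>kappa\<close> and a digit word. The
  interval is closed because the remainder may fill a whole cell, as it does at the right end of
  \<open>J M N\<close>.\<close>

definition cylinder :: "nat \<Rightarrow> nat \<Rightarrow> (nat \<Rightarrow> nat) \<Rightarrow> nat \<Rightarrow> nat \<times> (nat \<Rightarrow> nat) \<Rightarrow> real set" where
  "cylinder M N \<sigma> k c =
     (let l = (- real M - 1 + real (fst c)) / real N +
        (\<Sum>i\<in>{1..k}. real (snd c i) / (real N * scale \<sigma> i))
      in {l..l + 1 / (real N * scale \<sigma> k)})"

lemma diameter_cylinder: "diameter (cylinder M N \<sigma> k c) = 1 / (real N * scale \<sigma> k)"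
  using mult_nonneg_nonneg[of "real N", OF _ less_imp_le[OF scale_pos[of \<sigma> k]]]
  by (simp add: cylinder_def Let_def)

lemma greedy_word_in_digit_words:
  assumes "\<forall>i\<ge>1. \<sigma> i \<in> {0, 1}" "N \<ge> 1" "a \<in> J M N"
  shows "restrict (greedy_digit M N \<sigma> a) {1..k} \<in> digit_words \<sigma> k"
  using greedy_digit_less_base[OF assms] by auto

lemma mem_greedy_cylinder:
  assumes "\<forall>i\<ge>1. \<sigma> i \<in> {0, 1}" "N \<ge> 1" "a \<in> J M N"
  shows "a \<in> cylinder M N \<sigma> k (kappa M N a, restrict (greedy_digit M N \<sigma> a) {1..k})"
  using greedy_sum_bounds[OF assms, of k] unfolding greedy_sum_eq by (simp add: cylinder_def Let_def)

text \<open>Members of \<open>digit_words\<close> are \<open>undefined\<close> outside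
  \<open>{1..k}\<close>, so the greedy sequence has to be cut off to become one; the product reads
  only the positions 1 to k.\<close>

lemma A_prod_greedy_word:
  "A_prod M N \<sigma> (restrict (greedy_digit M N \<sigma> a) {1..k}) k = A_prod M N \<sigma> (greedy_digit M N \<sigma> a) k"
  by (rule A_prod_cong) auto

lemma finite_digit_words: "finite (digit_words \<sigma> k)"
  by (intro finite_PiE) auto

section \<open>Counting words of a given growth rate\<close>

text \<open>Multiplying the two-sided estimate by \<open>\<bar>q\<bar>\<close> yields a lower bound
  for either sign of \<open>q\<close>.\<close>

lemma powr_bounds_of_ln:
  fixes y q \<alpha> \<epsilon> L :: real
  assumes "y > 0" "\<bar>ln y - \<alpha> * L\<bar> \<le> \<epsilon> * L"
  shows "exp ((q * \<alpha> - \<bar>q\<bar> * \<epsilon>) * L) \<le> y powr q"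
proof -
  have "\<bar>q * (ln y - \<alpha> * L)\<bar> \<le> \<bar>q\<bar> * (\<epsilon> * L)"
    using assms(2) by (simp add: abs_mult mult_left_mono)
  then have "(q * \<alpha> - \<bar>q\<bar> * \<epsilon>) * L \<le> q * ln y" by (simp add: algebra_simps abs_le_iff)
  then show ?thesis using assms(1) by (simp add: powr_def)
qed

text \<open>The norm lies between the powers \<alpha> - \<epsilon> and \<alpha> + \<epsilon> of
  \<open>scale \<sigma> k\<close>. The denominator is cleared because
  \<open>ln (scale \<sigma> 0) = 0\<close>.\<close>

definition good_words :: "nat \<Rightarrow> nat \<Rightarrow> (nat \<Rightarrow> nat) \<Rightarrow> real \<Rightarrow> real \<Rightarrow> nat \<Rightarrow> (nat \<Rightarrow> nat) set" where
  "good_words M N \<sigma> \<alpha> \<epsilon> k = {x \<in> digit_words \<sigma> k.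
     \<bar>ln (sum_mat (A_prod M N \<sigma> x k)) - \<alpha> * ln (scale \<sigma> k)\<bar> \<le> \<epsilon> * ln (scale \<sigma> k)}"

definition partition_sum :: "nat \<Rightarrow> nat \<Rightarrow> (nat \<Rightarrow> nat) \<Rightarrow> real \<Rightarrow> nat \<Rightarrow> real" where
  "partition_sum M N \<sigma> q k = (\<Sum>x\<in>digit_words \<sigma> k. sum_mat (A_prod M N \<sigma> x k) powr q)"

lemma pressure_eq:
  "pressure M N \<sigma> q = limsup (\<lambda>k. ereal (1 / real k * ln (partition_sum M N \<sigma> q k)))"
  by (simp add: pressure_def partition_sum_def)

lemma sum_mat_digit_word_pos:
  assumes "N \<ge> 1" "x \<in> digit_words \<sigma> k"
  shows "0 < sum_mat (A_prod M N \<sigma> x k)"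
proof -
  have "1 \<le> sum_mat (A_prod M N \<sigma> x k)"
    using assms by (intro sum_mat_A_prod_ge_1) auto
  then show ?thesis by simp
qed

text \<open>Chebyshev: each good word contributes at least the exponential factor to the partition
  sum, and the remaining terms are nonnegative.\<close>

lemma card_good_words_le:
  assumes "N \<ge> 1"
  shows "real (card (good_words M N \<sigma> \<alpha> \<epsilon> k)) * exp ((q * \<alpha> - \<bar>q\<bar> * \<epsilon>) * ln (scale \<sigma> k))
    \<le> partition_sum M N \<sigma> q k"
proof -
  have "real (card (good_words M N \<sigma> \<alpha> \<epsilon> k)) * exp ((q * \<alpha> - \<bar>q\<bar> * \<epsilon>) * ln (scale \<sigma> k))
      \<le> (\<Sum>x\<in>good_words M N \<sigma> \<alpha> \<epsilon> k. sum_mat (A_prod M N \<sigma> x k) powr q)"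
    using assms
    by (intro sum_bounded_below powr_bounds_of_ln) (auto simp: good_words_def sum_mat_digit_word_pos)
  also have "\<dots> \<le> partition_sum M N \<sigma> q k"
    unfolding partition_sum_def
    by (intro sum_mono2 finite_digit_words) (auto simp: good_words_def)
  finally show ?thesis .
qed

lemma partition_sum_pos:
  assumes "N \<ge> 1"
  shows "0 < partition_sum M N \<sigma> q k"
proof -
  have "digit_words \<sigma> k \<noteq> {}"
    by (auto simp: PiE_eq_empty_iff base_def lessThan_empty_iff)
  moreover have "0 < sum_mat (A_prod M N \<sigma> x k) powr q" if "x \<in> digit_words \<sigma> k" for x
    using sum_mat_digit_word_pos[OF assms that, of M] by simp
  ultimately show ?thesis
    unfolding partition_sum_def by (intro sum_pos finite_digit_words)
qed

lemma ln_scale_div_tendsto: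
  assumes "(\<lambda>k. real (occ \<sigma> 0 k) / real k) \<longlonglongrightarrow> n0"
    and "(\<lambda>k. real (occ \<sigma> 1 k) / real k) \<longlonglongrightarrow> n1"
  shows "(\<lambda>k. ln (scale \<sigma> k) / real k) \<longlonglongrightarrow> n0 * ln 3 + n1 * ln 4"
proof -
  have "(\<lambda>k. real (occ \<sigma> 0 k) / real k * ln 3 + real (occ \<sigma> 1 k) / real k * ln 4)
      \<longlonglongrightarrow> n0 * ln 3 + n1 * ln 4"
    by (intro tendsto_intros assms)
  then show ?thesis by (simp add: ln_scale add_divide_distrib)
qed

text \<open>Each position contributes \<open>ln 3\<close> or \<open>ln 4\<close>. The bound makes
  the limit of \<open>ln (scale \<sigma> k) / k\<close> positive and the cylinder diameters
  decay.\<close>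

lemma ln_scale_ge:
  assumes "\<forall>i\<ge>1. \<sigma> i \<in> {0, 1}"
  shows "real k * ln 3 \<le> ln (scale \<sigma> k)"
proof -
  have "real k = real (occ \<sigma> 0 k) + real (occ \<sigma> 1 k)"
    using occ_0_plus_occ_1[OF assms, of k] by simp
  then show ?thesis
    by (simp add: ln_scale distrib_right mult_left_mono)
qed

section \<open>Growth along greedy words and the lower pressure bound\<close>

text \<open>The convergence to \<alpha> is multiplied through by
  \<open>ln (scale \<sigma> k)\<close>, which is positive for k > 0.\<close>

lemma E_level_imp_good:
  assumes "\<forall>i\<ge>1. \<sigma> i \<in> {0, 1}" "N \<ge> 1" "a \<in> E_level \<theta> M N \<sigma> \<alpha>" "\<epsilon> > 0"
  shows "\<forall>\<^sub>F k in sequentially. restrict (greedy_digit M N \<sigma> a) {1..k} \<in> good_words M N \<sigma> \<alpha> \<epsilon> k"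
proof -
  have a: "a \<in> J M N" and lim: "(\<lambda>k. ln (sum_mat (A_prod M N \<sigma> (greedy_digit M N \<sigma> a) k)) /
      ln (scale \<sigma> k)) \<longlonglongrightarrow> \<alpha>"
    using assms(3) by (auto simp: E_level_def ln_scale)
  have "\<forall>\<^sub>F k in sequentially. dist (ln (sum_mat (A_prod M N \<sigma> (greedy_digit M N \<sigma> a) k)) /
      ln (scale \<sigma> k)) \<alpha> < \<epsilon>"
    using tendstoD[OF lim \<open>\<epsilon> > 0\<close>] .
  then show ?thesis
    using eventually_gt_at_top[of 0]
  proof eventually_elim
    case (elim k)
    define L where "L = ln (scale \<sigma> k)"
    define v where "v = ln (sum_mat (A_prod M N \<sigma> (greedy_digit M N \<sigma> a) k))"
    have "0 < real k * ln 3" using elim by simp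
    then have "L > 0" using ln_scale_ge[OF assms(1), of k] unfolding L_def by linarith
    have "v - \<alpha> * L = (v / L - \<alpha>) * L" using \<open>L > 0\<close> by (simp add: field_simps)
    then have "\<bar>v - \<alpha> * L\<bar> = \<bar>v / L - \<alpha>\<bar> * L" using \<open>L > 0\<close> by (simp add: abs_mult)
    also have "\<dots> \<le> \<epsilon> * L"
      using elim(1) \<open>L > 0\<close> by (intro mult_right_mono) (auto simp: dist_real_def v_def L_def)
    finally show ?case
      using greedy_word_in_digit_words[OF assms(1,2) a]
      unfolding good_words_def v_def L_def by (simp add: A_prod_greedy_word del: One_nat_def)
  qed
qed

text \<open>The greedy word of the single point \<open>a\<close> already bounds the partition sum
  from below. This excludes the pressure value -\<infinity> and makes the bound for the dimension
  nonnegative.\<close>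

lemma pressure_ge:
  assumes \<sigma>: "\<forall>i\<ge>1. \<sigma> i \<in> {0, 1}" and N: "N \<ge> 1"
    and lam: "(\<lambda>k. ln (scale \<sigma> k) / real k) \<longlonglongrightarrow> \<Lambda>"
    and a: "a \<in> E_level \<theta> M N \<sigma> \<alpha>"
  shows "ereal (q * \<alpha> * \<Lambda>) \<le> pressure M N \<sigma> q"
proof -
  have "ereal ((q * \<alpha> - \<bar>q\<bar> * \<epsilon>) * \<Lambda>) \<le> pressure M N \<sigma> q" if "\<epsilon> > 0" for \<epsilon>
  proof -
    have "(\<lambda>k. ereal ((q * \<alpha> - \<bar>q\<bar> * \<epsilon>) * (ln (scale \<sigma> k) / real k)))
        \<longlonglongrightarrow> ereal ((q * \<alpha> - \<bar>q\<bar> * \<epsilon>) * \<Lambda>)"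
      by (intro tendsto_intros lam)
    then have "ereal ((q * \<alpha> - \<bar>q\<bar> * \<epsilon>) * \<Lambda>) =
        limsup (\<lambda>k. ereal ((q * \<alpha> - \<bar>q\<bar> * \<epsilon>) * (ln (scale \<sigma> k) / real k)))"
      by (intro lim_imp_Limsup[symmetric]) auto
    also have "\<dots> \<le> pressure M N \<sigma> q"
      unfolding pressure_eq
    proof (intro Limsup_mono)
      show "\<forall>\<^sub>F k in sequentially. ereal ((q * \<alpha> - \<bar>q\<bar> * \<epsilon>) * (ln (scale \<sigma> k) / real k))
          \<le> ereal (1 / real k * ln (partition_sum M N \<sigma> q k))"
        using E_level_imp_good[OF \<sigma> N a that]
      proof eventually_elim
        case (elim k)
        have "finite (good_words M N \<sigma> \<alpha> \<epsilon> k)"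
          using finite_digit_words by (simp add: good_words_def)
        then have "1 \<le> real (card (good_words M N \<sigma> \<alpha> \<epsilon> k))"
          using elim by (auto simp: Suc_le_eq card_gt_0_iff)
        then have "1 * exp ((q * \<alpha> - \<bar>q\<bar> * \<epsilon>) * ln (scale \<sigma> k)) \<le> partition_sum M N \<sigma> q k"
          by (rule order_trans[OF mult_right_mono card_good_words_le[OF N]]) simp
        then have "(q * \<alpha> - \<bar>q\<bar> * \<epsilon>) * ln (scale \<sigma> k) \<le> ln (partition_sum M N \<sigma> q k)"
          using partition_sum_pos[OF N] by (simp add: ln_ge_iff)
        then show ?case by (simp add: divide_right_mono)
      qed
    qed
    finally show ?thesis .
  qed
  \<comment> \<open>The tolerance is removed by letting \<epsilon> tend to 0 from the right.\<close>
  moreover have "((\<lambda>\<epsilon>. ereal ((q * \<alpha> - \<bar>q\<bar> * \<epsilon>) * \<Lambda>)) \<longlongrightarrow> ereal ((q * \<alpha> - \<bar>q\<bar> * 0) * \<Lambda>)) (at_right 0)"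
    by (intro tendsto_intros)
  moreover from calculation(1)
  have "\<forall>\<^sub>F \<epsilon> in at_right 0. ereal ((q * \<alpha> - \<bar>q\<bar> * \<epsilon>) * \<Lambda>) \<le> pressure M N \<sigma> q"
    by (rule eventually_mono[OF eventually_at_right_less])
  ultimately have "ereal ((q * \<alpha> - \<bar>q\<bar> * 0) * \<Lambda>) \<le> pressure M N \<sigma> q"
    by (intro tendsto_upperbound) auto
  then show ?thesis by simp
qed

section \<open>Covers of the level set\<close>

lemma hausdorff_measure_E_level_eq_0:
  assumes \<sigma>: "\<forall>i\<ge>1. \<sigma> i \<in> {0, 1}" and N: "N \<ge> 1"
    and lam: "(\<lambda>k. ln (scale \<sigma> k) / real k) \<longlonglongrightarrow> \<Lambda>" "\<Lambda> > 0"
    and p: "pressure M N \<sigma> q = ereal p"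
    and s: "s > 0" "s > - q * \<alpha> + p / \<Lambda>"
  shows "hausdorff_measure s (E_level \<theta> M N \<sigma> \<alpha>) = 0"
proof -
  \<comment> \<open>The strict inequality for \<open>s\<close> survives the loss
    \<open>\<bar>q\<bar> * \<epsilon>\<close> once \<epsilon> is small enough.\<close>
  have "((\<lambda>\<epsilon>. s + q * \<alpha> - \<bar>q\<bar> * \<epsilon>) \<longlongrightarrow> s + q * \<alpha> - \<bar>q\<bar> * 0) (at_right 0)"
    by (intro tendsto_intros)
  then have "\<forall>\<^sub>F \<epsilon> in at_right 0. p / \<Lambda> < s + q * \<alpha> - \<bar>q\<bar> * \<epsilon>"
    using s by (intro order_tendstoD(1)) auto
  then have "\<forall>\<^sub>F \<epsilon> in at_right 0. p / \<Lambda> < s + q * \<alpha> - \<bar>q\<bar> * \<epsilon> \<and> 0 < \<epsilon>"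
    using eventually_at_right_less by (rule eventually_conj)
  then obtain \<epsilon> where \<epsilon>: "p / \<Lambda> < s + q * \<alpha> - \<bar>q\<bar> * \<epsilon>" "0 < \<epsilon>"
    using eventually_happens' trivial_limit_at_right_real by blast
  define D where "D = s + q * \<alpha> - \<bar>q\<bar> * \<epsilon>"
  \<comment> \<open>A third of the gap: one share is lost in the limsup of the pressure, one in the
    convergence of \<open>ln (scale \<sigma> k) / k\<close>, and the last gives the geometric ratio
    \<open>exp (- c)\<close>.\<close>
  define c where "c = (D * \<Lambda> - p) / 3"
  have "p < D * \<Lambda>" using \<epsilon>(1) lam(2) by (simp add: D_def field_simps)
  then have "c > 0" by (simp add: c_def)
  define C where "C k = cylinder M N \<sigma> k ` ({1..N + M} \<times> good_words M N \<sigma> \<alpha> \<epsilon> k)" for k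
  have fin: "finite (good_words M N \<sigma> \<alpha> \<epsilon> k)" for k
    using finite_digit_words by (simp add: good_words_def)
  have upper: "\<forall>\<^sub>F k in sequentially. 1 / real k * ln (partition_sum M N \<sigma> q k) < p + c"
  proof -
    have "limsup (\<lambda>k. ereal (1 / real k * ln (partition_sum M N \<sigma> q k))) < ereal (p + c)"
      using p \<open>c > 0\<close> by (simp add: pressure_eq)
    then show ?thesis using Limsup_lessD by fastforce
  qed
  \<comment> \<open>\<open>D\<close> may have either sign, so the estimate is taken from the limit
    of the whole product.\<close>
  have lower: "\<forall>\<^sub>F k in sequentially. D * \<Lambda> - c < D * (ln (scale \<sigma> k) / real k)"
    using \<open>c > 0\<close> by (intro order_tendstoD(1)[OF tendsto_mult_left[OF lam(1)]]) auto
  show ?thesis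
  proof (rule hausdorff_measure_eq_0_if_limsup_cover[where C = C])
    show "finite (C k)" for k using fin by (simp add: C_def)
    show "\<exists>\<^sub>F k in sequentially. a \<in> \<Union>(C k)" if "a \<in> E_level \<theta> M N \<sigma> \<alpha>" for a
    proof (rule eventually_frequently)
      have "a \<in> J M N" using that by (simp add: E_level_def)
      show "\<forall>\<^sub>F k in sequentially. a \<in> \<Union>(C k)"
        using E_level_imp_good[OF \<sigma> N that \<epsilon>(2)]
      proof eventually_elim
        case (elim k)
        then show ?case
          unfolding C_def
          using mem_greedy_cylinder[OF \<sigma> N \<open>a \<in> J M N\<close>, of k] kappa_bounds(1)[OF N \<open>a \<in> J M N\<close>]
          by blast
      qed
    qed simp
    show "bounded U \<and> diameter U \<le> (1 / 3) ^ k" if U: "U \<in> C k" for k U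
    proof -
      have "exp (real k * ln 3) \<le> scale \<sigma> k"
        using ln_scale_ge[OF \<sigma>, of k] scale_pos[of \<sigma> k] by (simp add: ln_ge_iff)
      then have "3 ^ k \<le> scale \<sigma> k" by (simp add: exp_of_nat_mult)
      also have "\<dots> \<le> real N * scale \<sigma> k" using N scale_pos[of \<sigma> k] by simp
      finally have "1 / (real N * scale \<sigma> k) \<le> 1 / 3 ^ k"
        by (intro divide_left_mono mult_pos_pos) (use N scale_pos[of \<sigma> k] in auto)
      moreover have "bounded U" using U by (auto simp: C_def cylinder_def Let_def)
      moreover have "diameter U = 1 / (real N * scale \<sigma> k)"
        using U by (auto simp: C_def diameter_cylinder)
      ultimately show ?thesis by (simp add: power_one_over)
    qed
    show "(\<lambda>k. (1 / 3 :: real) ^ k) \<longlonglongrightarrow> 0" by (intro LIMSEQ_realpow_zero) auto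
    show "\<forall>\<^sub>F k in sequentially. (\<Sum>U\<in>C k. diam_power s U) \<le> ennreal (real (N + M) * exp (- c) ^ k)"
      using upper lower eventually_gt_at_top[of 0]
    proof eventually_elim
      case (elim k)
      define L where "L = ln (scale \<sigma> k)"
      have expL: "exp L = scale \<sigma> k" using scale_pos by (simp add: L_def)
      let ?G = "good_words M N \<sigma> \<alpha> \<epsilon> k"
      have diam: "diam_power s U \<le> ennreal (exp (- s * L))" if "U \<in> C k" for U
      proof -
        have "1 / (real N * scale \<sigma> k) \<le> exp (- L)"
          using N expL[symmetric] by (simp add: exp_minus field_simps)
        then have "(1 / (real N * scale \<sigma> k)) powr s \<le> exp (- L) powr s"
          using s(1) scale_pos[of \<sigma> k] by (intro powr_mono2) auto
        then have "diameter U powr s \<le> exp (- s * L)"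
          using that by (auto simp: C_def diameter_cylinder powr_def)
        \<comment> \<open>Positivity of \<open>s\<close> selects the \<open>powr\<close> branch of
          \<open>diam_power\<close>.\<close>
        then show ?thesis using s(1) by (auto simp: diam_power_def ennreal_leI)
      qed
      have "(\<Sum>U\<in>C k. diam_power s U) \<le> of_nat (card (C k)) * ennreal (exp (- s * L))"
        using diam by (rule sum_bounded_above)
      also have "\<dots> \<le> of_nat ((N + M) * card ?G) * ennreal (exp (- s * L))"
      proof (intro mult_right_mono of_nat_mono)
        have "card (C k) \<le> card ({1..N + M} \<times> ?G)"
          unfolding C_def using fin by (intro card_image_le) auto
        then show "card (C k) \<le> (N + M) * card ?G" by (simp add: card_cartesian_product)
      qed simp
      also have "\<dots> = ennreal (real (N + M) * (real (card ?G) * exp (- s * L)))"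
        by (simp add: ennreal_of_nat_eq_real_of_nat flip: ennreal_mult)
      also have "\<dots> \<le> ennreal (real (N + M) * exp (- c) ^ k)"
      proof (intro ennreal_leI mult_left_mono)
        have "real (card ?G) * exp ((q * \<alpha> - \<bar>q\<bar> * \<epsilon>) * L) \<le> exp (real k * (p + c))"
        proof -
          have "ln (partition_sum M N \<sigma> q k) \<le> real k * (p + c)"
            using elim by (simp add: field_simps)
          then have "partition_sum M N \<sigma> q k \<le> exp (real k * (p + c))"
            using partition_sum_pos[OF N, of M \<sigma> q k] by (metis exp_le_cancel_iff exp_ln)
          then show ?thesis
            using card_good_words_le[OF N, of M \<sigma> \<alpha> \<epsilon> k q] unfolding L_def by linarith
        qed
        \<comment> \<open>The factor \<open>exp (- D * L)\<close> turns the exponent from the count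
          into the cost exponent \<open>- s * L\<close>.\<close>
        then have "real (card ?G) * exp ((q * \<alpha> - \<bar>q\<bar> * \<epsilon>) * L) * exp (- D * L)
            \<le> exp (real k * (p + c)) * exp (- D * L)"
          by (intro mult_right_mono) auto
        moreover have "(q * \<alpha> - \<bar>q\<bar> * \<epsilon>) * L + - D * L = - s * L"
          by (simp add: D_def algebra_simps)
        ultimately have "real (card ?G) * exp (- s * L) \<le> exp (real k * (p + c) + - D * L)"
          by (metis exp_add mult.assoc)
        also have "\<dots> \<le> exp (real k * - c)"
        proof -
          have "real k * (D * \<Lambda> - c) \<le> D * L"
            using elim by (simp add: L_def field_simps)
          moreover have "D * \<Lambda> = 3 * c + p" by (simp add: c_def field_simps)
          ultimately have "real k * (p + 2 * c) \<le> D * L" by (simp add: algebra_simps)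
          then show ?thesis by (simp add: algebra_simps)
        qed
        also have "\<dots> = exp (- c) ^ k" by (rule exp_of_nat_mult)
        finally show "real (card ?G) * exp (- s * L) \<le> exp (- c) ^ k" .
      qed simp
      finally show ?case .
    qed
    show "0 \<le> real (N + M) * exp (- c) ^ k" for k by simp
    show "summable (\<lambda>k. real (N + M) * exp (- c) ^ k)"
      using \<open>c > 0\<close> by (intro summable_mult summable_geometric) auto
  qed
qed

section \<open>The dimension bound for every q\<close>

theorem theorem3:
  fixes \<theta> \<alpha> n0 n1 :: real and M N :: nat and \<sigma> :: "nat \<Rightarrow> nat"
  assumes "0 \<le> \<theta>" and "\<theta> < pi / 2"
    and "N \<ge> 1" and "tan \<theta> = real M / real N"
    and "\<And>i. i \<ge> 1 \<Longrightarrow> \<sigma> i \<in> {0, 1}"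
    and "(\<lambda>k. real (occ \<sigma> 0 k) / real k) \<longlonglongrightarrow> n0"
    and "(\<lambda>k. real (occ \<sigma> 1 k) / real k) \<longlonglongrightarrow> n1"
    and "E_level \<theta> M N \<sigma> \<alpha> \<noteq> {}"
  shows "hausdorff_dim (E_level \<theta> M N \<sigma> \<alpha>) \<le>
    (INF q::real. ereal (- q * \<alpha>) + pressure M N \<sigma> q / ereal (n0 * ln 3 + n1 * ln 4))"
proof (rule INF_greatest)
  fix q :: real
  have \<sigma>: "\<forall>i\<ge>1. \<sigma> i \<in> {0, 1}" using assms(5) by blast
  define \<Lambda> where "\<Lambda> = n0 * ln 3 + n1 * ln 4"
  have lam: "(\<lambda>k. ln (scale \<sigma> k) / real k) \<longlonglongrightarrow> \<Lambda>"
    unfolding \<Lambda>_def using assms(6,7) by (rule ln_scale_div_tendsto)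
  have "\<forall>\<^sub>F k in sequentially. ln 3 \<le> ln (scale \<sigma> k) / real k"
    using eventually_gt_at_top[of 0]
  proof eventually_elim
    case (elim k)
    then show ?case using ln_scale_ge[OF \<sigma>, of k] by (simp add: field_simps)
  qed
  then have "ln 3 \<le> \<Lambda>" using lam by (intro tendsto_lowerbound) auto
  moreover have "(0::real) < ln 3" by simp
  ultimately have "\<Lambda> > 0" by linarith
  obtain a where "a \<in> E_level \<theta> M N \<sigma> \<alpha>" using assms(8) by blast
  then have ge: "ereal (q * \<alpha> * \<Lambda>) \<le> pressure M N \<sigma> q"
    using pressure_ge[OF \<sigma> assms(3) lam] by blast
  show "hausdorff_dim (E_level \<theta> M N \<sigma> \<alpha>) \<le>
      ereal (- q * \<alpha>) + pressure M N \<sigma> q / ereal (n0 * ln 3 + n1 * ln 4)"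
    unfolding \<Lambda>_def[symmetric]
  proof (cases "pressure M N \<sigma> q")
    case (real p)
    \<comment> \<open>Hence the bound is nonnegative and every \<open>s\<close> beyond it is
      positive, as the null measure lemma demands.\<close>
    then have "q * \<alpha> \<le> p / \<Lambda>" using ge \<open>\<Lambda> > 0\<close> by (simp add: field_simps)
    have "hausdorff_dim (E_level \<theta> M N \<sigma> \<alpha>) \<le> ereal s" if "s > - q * \<alpha> + p / \<Lambda>" for s
    proof -
      have "s > 0" using that \<open>q * \<alpha> \<le> p / \<Lambda>\<close> by simp
      then have "hausdorff_measure s (E_level \<theta> M N \<sigma> \<alpha>) = 0"
        using hausdorff_measure_E_level_eq_0[OF \<sigma> assms(3) lam \<open>\<Lambda> > 0\<close> real] that by blast
      then show ?thesis
        unfolding hausdorff_dim_def using \<open>s > 0\<close> by (intro Inf_lower) auto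
    qed
    then have "hausdorff_dim (E_level \<theta> M N \<sigma> \<alpha>) \<le> ereal (- q * \<alpha> + p / \<Lambda>) + ereal e"
      if "e > 0" for e
      using that unfolding plus_ereal.simps by (smt (verit))
    then have "hausdorff_dim (E_level \<theta> M N \<sigma> \<alpha>) \<le> ereal (- q * \<alpha> + p / \<Lambda>)"
      by (rule ereal_le_epsilon2)
    then show "hausdorff_dim (E_level \<theta> M N \<sigma> \<alpha>) \<le> ereal (- q * \<alpha>) + pressure M N \<sigma> q / ereal \<Lambda>"
      using real \<open>\<Lambda> > 0\<close> by simp
  \<comment> \<open>Pressure \<infinity> makes the right-hand side \<infinity>, and -\<infinity>
    contradicts \<open>ge\<close>.\<close>
  qed (use ge \<open>\<Lambda> > 0\<close> in auto)
qed

end
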